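(* Let $f:\mathbb{C}\to\mathbb{C}$ be a transcendental entire function, let $D$ be an open disc meeting $J(f)$, and suppose that there exists a bounded domain $U\subset\mathbb{C}$ with $\partial U\subset B_D(f)$ and $U\cap J(f)\neq\emptyset$. Then $F(f)$ has no unbounded components.
   Context: $\mathbb{N}=\{1,2,3,\dots\}$ and $f^n$ denotes the $n$th iterate of $f$. The Fatou set $F(f)$ is the set of $z\in\mathbb{C}$ such that $(f^n)_{n\in\mathbb{N}}$ is a normal family in some neighbourhood of $z$; the Julia set is $J(f)=\mathbb{C}\setminus F(f)$. A domain is a non-empty connected open set. For a bounded domain $G$, $\widetilde{G}$ denotes the union of $G$ and the bounded components of $\mathbb{C}\setminus G$. For an open disc $D$ meeting $J(f)$, $B_D(f)=\{z\in\mathbb{C}: f^n(z)\notin\widetilde{f^n(D)} \text{ for all } n\in\mathbb{N}\}$. *)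

theory Defs
  imports "HOL-Complex_Analysis.Complex_Analysis" "HOL-Computational_Algebra.Polynomial"
begin

definition transcendental_entire :: "(complex \<Rightarrow> complex) \<Rightarrow> bool" where
  "transcendental_entire f \<longleftrightarrow>
     f holomorphic_on UNIV \<and> \<not> (\<exists>p :: complex poly. \<forall>z. f z = poly p z)"

definition plane_domain :: "complex set \<Rightarrow> bool" where
  "plane_domain G \<longleftrightarrow> open G \<and> connected G \<and> G \<noteq> {}"

text \<open>
  Normality of a family of holomorphic functions on a domain is understood in the sense of
  complex dynamics: the constant limit infinity is allowed. On a connected open set this is
  the same as normality with respect to the spherical metric.
\<close>

definition normal_family_on :: "complex set \<Rightarrow> (complex \<Rightarrow> complex) set \<Rightarrow> bool" where
  "normal_family_on S \<F> \<longleftrightarrow>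
     (\<forall>s :: nat \<Rightarrow> complex \<Rightarrow> complex. (\<forall>n. s n \<in> \<F>) \<longrightarrow>
        (\<exists>r :: nat \<Rightarrow> nat. strict_mono r \<and>
           ((\<exists>g. g holomorphic_on S \<and>
                 (\<forall>K. compact K \<and> K \<subseteq> S \<longrightarrow> uniform_limit K (s \<circ> r) g sequentially)) \<or>
            (\<forall>K. compact K \<and> K \<subseteq> S \<longrightarrow>
                 (\<forall>M::real. \<forall>\<^sub>F n in sequentially. \<forall>z\<in>K. norm (s (r n) z) > M)))))"

definition fatou_set :: "(complex \<Rightarrow> complex) \<Rightarrow> complex set" where
  "fatou_set f =
     {z. \<exists>S. plane_domain S \<and> z \<in> S \<and> normal_family_on S {f ^^ n | n. n \<ge> 1}}"

definition julia_set :: "(complex \<Rightarrow> complex) \<Rightarrow> complex set" where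
  "julia_set f = UNIV - fatou_set f"

definition fill_holes :: "complex set \<Rightarrow> complex set" where
  "fill_holes G = G \<union> \<Union>{C \<in> components (UNIV - G). bounded C}"

definition B_set :: "complex set \<Rightarrow> (complex \<Rightarrow> complex) \<Rightarrow> complex set" where
  "B_set D f = {z. \<forall>n\<ge>1. (f ^^ n) z \<notin> fill_holes ((f ^^ n) ` D)}"

end

theory Submission
  imports Defs
begin

text \<open>
  Suppose \<open>G\<close> is an unbounded component of the Fatou set. Since \<open>U\<close> meets the Julia set, some
  \<open>f\<^sup>k(U)\<close> meets \<open>G\<close>, and as \<open>G\<close> is connected and unbounded so does \<open>f\<^sup>k(\<partial>U)\<close>. Likewise
  \<open>f\<^sup>l\<close> maps some point of a smaller disc \<open>D'\<close> into \<open>G\<close>, and we may take \<open>k > l\<close>. So \<open>G\<close> contains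
  \<open>w\<^sub>0 = f\<^sup>l(\<zeta>)\<close> and \<open>w\<^sub>1 = f\<^sup>k(\<xi>)\<close> with \<open>\<zeta> \<in> D'\<close> and \<open>\<xi> \<in> B\<^sub>D(f)\<close>. Let \<open>b\<close> be the maximum of
  \<open>|f\<^sup>m\<^sup>+\<^sup>l|\<close> on \<open>D'\<close>, which is unbounded in \<open>m\<close>. By a Bohr type covering theorem (available because
  \<open>D'\<close> contains a point with bounded orbit) \<open>f\<^sup>m\<^sup>+\<^sup>l\<close> covers a circle of radius comparable to \<open>b\<close>,
  and since \<open>f\<^sup>k\<^sup>-\<^sup>l\<close> is transcendental, the filled image \<open>f\<^sup>m\<^sup>+\<^sup>k(D)\<close> contains a disc of radius
  at least a constant times \<open>b\<^sup>N\<close>, for every \<open>N\<close>. Hence \<open>|f\<^sup>m(w\<^sub>1)|\<close> exceeds every power of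
  \<open>b \<ge> |f\<^sup>m(w\<^sub>0)|\<close>. On the other hand \<open>f\<^sup>m\<close> tends to infinity locally uniformly on \<open>G\<close> along the chosen
  \<open>m\<close>, so it eventually omits 0 and 1 locally, and then Schottky's theorem bounds \<open>|f\<^sup>m(w\<^sub>1)|\<close> by a
  fixed power of \<open>|f\<^sup>m(w\<^sub>0)|\<close>.
\<close>

subsection \<open>Harnack type inequality for functions omitting two values\<close>

text \<open>The shift by 1 keeps this size nonnegative even near zeros. A linear bound between two
  sizes is a polynomial bound between the moduli.\<close>

definition log_size :: "complex \<Rightarrow> real" where
  "log_size z = ln (1 + norm z)"

lemma log_size_nonneg: "0 \<le> log_size z"
  by (simp add: log_size_def)

lemma log_size_le_iff: "log_size z \<le> ln (1 + M) \<longleftrightarrow> norm z \<le> M" if "0 \<le> M"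
  using that by (simp add: log_size_def add_pos_nonneg)

text \<open>Schottky's theorem in the library has a doubly exponential bound. Applying it to an N-th root
  of F with N about \<open>log |F a|\<close>, which is of bounded size at \<open>a\<close> and still omits 0 and 1, makes
  the bound polynomial.\<close>
lemma Schottky_log_size:
  obtains C where "C > 0"
    "\<And>F a d z. \<lbrakk>d > 0; F holomorphic_on ball a d; \<And>w. w \<in> ball a d \<Longrightarrow> F w \<notin> {0,1};
        norm (z - a) \<le> d / 4\<rbrakk> \<Longrightarrow> log_size (F z) \<le> C * (1 + log_size (F a))"
proof -
  \<comment> \<open>The Schottky bound at \<open>norm u = 1/2\<close> for a function of modulus at
    most \<open>exp 1\<close> at 0; the 12 is 12 * (1/2) / (1 - 1/2).\<close>
  define B :: real where "B = exp (pi * exp (pi * (2 + 2 * exp 1 + 12)))"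
  have B1: "B \<ge> 1" unfolding B_def by simp
  define C where "C = 2 * (ln B + 1)"
  have lnB: "ln B \<ge> 0" using B1 by simp
  show ?thesis
  proof (rule that[of C])
    show "C > 0" using lnB by (simp add: C_def)
    fix F a d z
    assume d: "d > (0::real)" and hol: "F holomorphic_on ball a d"
      and om: "\<And>w. w \<in> ball a d \<Longrightarrow> F w \<notin> {0,1}" and z: "norm (z - a) \<le> d / 4"
    obtain g where g: "g holomorphic_on ball a d" "\<And>x. x \<in> ball a d \<Longrightarrow> exp (g x) = F x"
      using holomorphic_logarithm_exists[of "ball a d" F a] hol om d by auto
    \<comment> \<open>\<open>N >= log_size (F a)\<close> brings the root below \<open>exp 1\<close>
      at the centre; the \<open>+ 1\<close> keeps \<open>N\<close> positive.\<close>
    define N where "N = nat \<lceil>log_size (F a)\<rceil> + 1"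
    have N: "real N \<ge> log_size (F a)" "real N \<le> log_size (F a) + 2" "N > 0"
      using log_size_nonneg[of "F a"] unfolding N_def by linarith+
    \<comment> \<open>The N-th root of F on the disc of radius d/2, rescaled to the unit disc;
      points within d/4 of \<open>a\<close> correspond to modulus at most 1/2.\<close>
    define h where "h u = exp (g (a + of_real (d/2) * u) / of_nat N)" for u
    have inb: "a + of_real (d/2) * u \<in> ball a d" if "u \<in> cball 0 1" for u
    proof -
      have "norm (of_real (d/2) * u) \<le> d/2 * 1" using that d unfolding norm_mult
        by (intro mult_mono) auto
      then show ?thesis using d by (simp add: dist_norm norm_minus_commute)
    qed
    have hN: "h u ^ N = F (a + of_real (d/2) * u)" if "u \<in> cball 0 1" for u
    proof -
      have "h u ^ N = exp (of_nat N * (g (a + of_real (d/2) * u) / of_nat N))"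
        unfolding h_def exp_of_nat_mult ..
      then show ?thesis using N(3) g(2)[OF inb[OF that]] by simp
    qed
    have holh: "h holomorphic_on cball 0 1"
    proof -
      have "(g \<circ> (\<lambda>u. a + of_real (d/2) * u)) holomorphic_on cball 0 1"
        using inb by (intro holomorphic_on_compose_gen[OF _ g(1)] holomorphic_intros) blast
      then have "(\<lambda>u. g (a + of_real (d/2) * u)) holomorphic_on cball 0 1"
        by (simp add: o_def)
      then show ?thesis unfolding h_def using N(3) by (intro holomorphic_intros) auto
    qed
    have h0: "norm (h 0) \<le> exp 1"
    proof -
      have "norm (h 0) ^ N = norm (F a)" using hN[of 0] by (simp flip: norm_power)
      also have "\<dots> \<le> exp (log_size (F a))" by (simp add: log_size_def add_pos_nonneg)
      also have "\<dots> \<le> exp (real N)" using N(1) by simp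
      also have "\<dots> = exp 1 ^ N" by (metis exp_of_nat_mult mult.right_neutral)
      finally show ?thesis using N(3) by (simp add: power_mono_iff)
    qed
    have h01: "\<not> (h u = 0 \<or> h u = 1)" if "u \<in> cball 0 1" for u
      using hN[OF that] om[OF inb[OF that]] N(3) by (auto simp: h_def)
    define u where "u = (z - a) / of_real (d/2)"
    have u: "norm u \<le> 1/2" using z d unfolding u_def norm_divide by (simp add: field_simps)
    have zu: "z = a + of_real (d/2) * u" using d by (simp add: u_def field_simps)
    have "norm (h u) \<le> exp(pi * exp(pi * (2 + 2 * exp 1 + 12 * (1/2) / (1 - (1/2)))))"
      by (rule Schottky[OF holh h0 h01]) (use u in auto)
    then have "norm (h u) \<le> B" by (simp add: B_def)
    then have "norm (h u) ^ N \<le> B ^ N" by (intro power_mono) auto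
    moreover have "norm (F z) = norm (h u) ^ N" using hN[of u] u zu by (simp flip: norm_power)
    ultimately have "norm (F z) \<le> B ^ N" by simp
    then have "1 + norm (F z) \<le> 2 * B ^ N" using one_le_power[OF B1, of N] by linarith
    then have "log_size (F z) \<le> ln (2 * B ^ N)" unfolding log_size_def
      by (subst ln_le_cancel_iff) (auto intro: add_pos_nonneg mult_pos_pos simp: B_def)
    also have "\<dots> = ln 2 + real N * ln B" using B1 by (simp add: ln_mult ln_realpow)
    also have "\<dots> \<le> real N * (ln B + 1)"
    proof -
      have "ln 2 \<le> (1::real)" using ln_2_less_1 by simp
      then show ?thesis using N(3) by (simp add: algebra_simps)
    qed
    also have "\<dots> \<le> (log_size (F a) + 2) * (ln B + 1)" using N(2) lnB by (intro mult_right_mono) auto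
    also have "\<dots> \<le> C * (1 + log_size (F a))" unfolding C_def
      using log_size_nonneg[of "F a"] lnB by (simp add: algebra_simps)
    finally show "log_size (F z) \<le> C * (1 + log_size (F a))" .
  qed
qed

text \<open>Lets the local comparisons be composed along chains of discs, with a constant
  independent of the functions.\<close>

lemma log_size_chain:
  assumes "log_size x \<le> C * (1 + log_size y)" "log_size y \<le> C' * (1 + log_size z)" "C > 0"
    "C' > 0"
  shows "log_size x \<le> (C * (1 + C')) * (1 + log_size z)"
proof -
  have "log_size x \<le> C * (1 + C' * (1 + log_size z))"
    using assms by (smt (verit) mult_left_mono)
  also have "\<dots> \<le> C * (1 + log_size z + C' * (1 + log_size z))"
    using assms(3) log_size_nonneg[of z] by (intro mult_left_mono) auto
  finally show ?thesis by (simp add: algebra_simps)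
qed

text \<open>Schottky's theorem compares nearby points, connectedness carries the comparison to any
  point of S, and compactness makes it uniform on K. The arbitrary filter covers both sequences
  (\<open>sequentially\<close>) and whole classes of functions (\<open>principal\<close>).\<close>

lemma log_size_harnack:
  fixes s :: "'i \<Rightarrow> complex \<Rightarrow> complex"
  assumes S: "open S" "connected S"
    and loc: "\<And>p. p \<in> S \<Longrightarrow> \<exists>r>0. \<forall>\<^sub>F i in F. s i holomorphic_on ball p r \<and> (\<forall>z\<in>ball p r. s i z \<notin> {0,1})"
    and K: "compact K" "K \<subseteq> S" and w: "w \<in> S"
  obtains C where "C > 0"
    "\<forall>\<^sub>F i in F. \<forall>z\<in>K. log_size (s i z) \<le> C * (1 + log_size (s i w)) \<and>
                        log_size (s i w) \<le> C * (1 + log_size (s i z))"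
proof -
  obtain C0 where C0: "C0 > 0" "\<And>F a d z. \<lbrakk>d > 0; F holomorphic_on ball a d;
        \<And>w. w \<in> ball a d \<Longrightarrow> F w \<notin> {0,1}; norm (z - a) \<le> d / 4\<rbrakk>
        \<Longrightarrow> log_size (F z) \<le> C0 * (1 + log_size (F a))"
    using Schottky_log_size by metis
  have "\<forall>p\<in>S. \<exists>\<rho>>0. \<forall>\<^sub>F i in F. \<forall>z\<in>ball p \<rho>. \<forall>w\<in>ball p \<rho>. log_size (s i z) \<le> C0 * (1 + log_size (s i w))"
  proof
    fix p assume p: "p \<in> S"
    obtain r where r: "r > 0"
      "\<forall>\<^sub>F i in F. s i holomorphic_on ball p r \<and> (\<forall>z\<in>ball p r. s i z \<notin> {0,1})"
      using loc[OF p] by blast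
    \<comment> \<open>With radius r/16, any two points are at distance at most (r/2)/4, and the disc
      of radius r/2 about either one stays inside \<open>ball p r\<close>.\<close>
    have "\<forall>\<^sub>F i in F. \<forall>z\<in>ball p (r/16). \<forall>w\<in>ball p (r/16). log_size (s i z) \<le> C0 * (1 + log_size (s i w))"
      using r(2)
    proof eventually_elim
      case (elim i)
      show ?case
      proof (intro ballI)
        fix z w assume zw: "z \<in> ball p (r/16)" "w \<in> ball p (r/16)"
        have sub: "ball w (r/2) \<subseteq> ball p r"
        proof
          fix x assume "x \<in> ball w (r/2)"
          then show "x \<in> ball p r" using zw(2) dist_triangle[of p x w] r(1) by simp
        qed
        show "log_size (s i z) \<le> C0 * (1 + log_size (s i w))"
        proof (rule C0(2)[where d = "r/2" and F = "s i" and a = w and z = z])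
          have "dist z w \<le> r/8" using zw dist_triangle3[of z w p] by (simp add: dist_commute)
          then show "norm (z - w) \<le> r/2/4" by (simp add: dist_norm)
        qed (use r elim sub in \<open>auto intro: holomorphic_on_subset\<close>)
      qed
    qed
    then show "\<exists>\<rho>>0. \<forall>\<^sub>F i in F. \<forall>z\<in>ball p \<rho>. \<forall>w\<in>ball p \<rho>. log_size (s i z) \<le> C0 * (1 + log_size (s i w))"
      using r(1) by (intro exI[of _ "r/16"]) auto
  qed
  from bchoice[OF this] obtain \<rho> where \<rho>: "\<And>p. p \<in> S \<Longrightarrow> \<rho> p > 0"
    "\<And>p. p \<in> S \<Longrightarrow> \<forall>\<^sub>F i in F. \<forall>z\<in>ball p (\<rho> p). \<forall>w\<in>ball p (\<rho> p). log_size (s i z) \<le> C0 * (1 + log_size (s i w))"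
    by blast
  \<comment> \<open>Eventual comparability is an equivalence relation that holds locally, hence on
    all of the connected set S.\<close>
  define R where "R z w \<longleftrightarrow> (\<exists>C>0. \<forall>\<^sub>F i in F. log_size (s i z) \<le> C * (1 + log_size (s i w)) \<and>
                        log_size (s i w) \<le> C * (1 + log_size (s i z)))" for z w
  have R: "R p w" if p: "p \<in> S" for p
    using S(2) p w
  proof (rule connected_equivalence_relation)
    fix x y assume "R x y" then show "R y x" unfolding R_def
      by (elim exE conjE) (rule exI, rule conjI, assumption, erule eventually_mono, auto)
  next
    fix x y z assume xy: "R x y" and yz: "R y z"
    obtain C1 where C1: "C1 > 0" "\<forall>\<^sub>F i in F. log_size (s i x) \<le> C1 * (1 + log_size (s i y)) \<and>
                        log_size (s i y) \<le> C1 * (1 + log_size (s i x))" using xy R_def by auto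
    obtain C2 where C2: "C2 > 0" "\<forall>\<^sub>F i in F. log_size (s i y) \<le> C2 * (1 + log_size (s i z)) \<and>
                        log_size (s i z) \<le> C2 * (1 + log_size (s i y))" using yz R_def by auto
    define C where "C = C1 * (1 + C2) + C2 * (1 + C1)"
    have "C > 0" using C1(1) C2(1) by (simp add: C_def add_pos_pos)
    moreover have "\<forall>\<^sub>F i in F. log_size (s i x) \<le> C * (1 + log_size (s i z)) \<and>
                        log_size (s i z) \<le> C * (1 + log_size (s i x))"
      using C1(2) C2(2)
    proof eventually_elim
      case (elim i)
      have "log_size (s i x) \<le> (C1 * (1 + C2)) * (1 + log_size (s i z))"
        by (rule log_size_chain[of _ _ "s i y"]) (use elim C1 C2 in auto)
      also have "\<dots> \<le> C * (1 + log_size (s i z))"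
        using C1(1) C2(1) log_size_nonneg[of "s i z"] unfolding C_def by (intro mult_right_mono) auto
      finally have 1: "log_size (s i x) \<le> C * (1 + log_size (s i z))" .
      have "log_size (s i z) \<le> (C2 * (1 + C1)) * (1 + log_size (s i x))"
        by (rule log_size_chain[of _ _ "s i y"]) (use elim C1 C2 in auto)
      also have "\<dots> \<le> C * (1 + log_size (s i x))"
        using C1(1) C2(1) log_size_nonneg[of "s i x"] unfolding C_def by (intro mult_right_mono) auto
      finally show ?case using 1 by auto
    qed
    ultimately show "R x z" unfolding R_def by blast
  next
    fix a assume a: "a \<in> S"
    have "R a x" if "x \<in> ball a (\<rho> a)" for x
      unfolding R_def
    proof (rule exI, rule conjI)
      show "C0 > 0" by (rule C0)
      show "\<forall>\<^sub>F i in F. log_size (s i a) \<le> C0 * (1 + log_size (s i x)) \<and>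
                        log_size (s i x) \<le> C0 * (1 + log_size (s i a))"
        using \<rho>(2)[OF a] by eventually_elim (use that \<rho>(1)[OF a] in auto)
    qed
    then show "\<exists>T. openin (top_of_set S) T \<and> a \<in> T \<and> (\<forall>x\<in>T. R a x)"
      using a \<rho>(1)[OF a] by (intro exI[of _ "S \<inter> ball a (\<rho> a)"]) (auto simp: openin_open_Int)
  qed
  then have "\<forall>p\<in>S. R p w" by blast
  from bchoice[OF this[unfolded R_def]] obtain Cp where Cp: "\<And>p. p \<in> S \<Longrightarrow> Cp p > 0"
    "\<And>p. p \<in> S \<Longrightarrow> \<forall>\<^sub>F i in F. log_size (s i p) \<le> Cp p * (1 + log_size (s i w)) \<and>
                        log_size (s i w) \<le> Cp p * (1 + log_size (s i p))"
    by blast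
  have "K \<subseteq> (\<Union>p\<in>K. ball p (\<rho> p))"
  proof
    fix x assume x: "x \<in> K"
    then have "\<rho> x > 0" using \<rho>(1) K(2) by blast
    then show "x \<in> (\<Union>p\<in>K. ball p (\<rho> p))" using x by force
  qed
  then obtain Q where Q: "Q \<subseteq> K" "finite Q" "K \<subseteq> (\<Union>p\<in>Q. ball p (\<rho> p))"
    using compactE_image[OF K(1), of K "\<lambda>p. ball p (\<rho> p)"] by auto
  \<comment> \<open>The sum dominates each of the finitely many constants of the cover; the 1 keeps
    it positive when \<open>Q\<close> is empty.\<close>
  define C where "C = 1 + (\<Sum>p\<in>Q. C0 * (1 + Cp p) + Cp p * (1 + C0))"
  have tpos: "C0 * (1 + Cp p) \<ge> 0" "Cp p * (1 + C0) \<ge> 0" if "p \<in> Q" for p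
    using that Q K Cp(1)[of p] C0(1) by auto
  have Cpos: "C > 0" unfolding C_def using tpos by (intro add_pos_nonneg sum_nonneg) force+
  have CQ: "C0 * (1 + Cp p) \<le> C" "Cp p * (1 + C0) \<le> C" if "p \<in> Q" for p
  proof -
    have "C0 * (1 + Cp p) + Cp p * (1 + C0) \<le> (\<Sum>p\<in>Q. C0 * (1 + Cp p) + Cp p * (1 + C0))"
      using that Q(2) tpos by (intro member_le_sum) force+
    then show "C0 * (1 + Cp p) \<le> C" "Cp p * (1 + C0) \<le> C" using tpos[OF that] by (auto simp: C_def)
  qed
  show ?thesis
  proof (rule that[OF Cpos])
    have "\<forall>\<^sub>F i in F. \<forall>p\<in>Q. log_size (s i p) \<le> Cp p * (1 + log_size (s i w)) \<and>
                        log_size (s i w) \<le> Cp p * (1 + log_size (s i p))"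
      using Q K Cp(2) by (intro eventually_ball_finite) auto
    moreover have "\<forall>\<^sub>F i in F. \<forall>p\<in>Q. \<forall>z\<in>ball p (\<rho> p). \<forall>w\<in>ball p (\<rho> p). log_size (s i z) \<le> C0 * (1 + log_size (s i w))"
      using Q K \<rho>(2) by (intro eventually_ball_finite) auto
    ultimately show "\<forall>\<^sub>F i in F. \<forall>z\<in>K. log_size (s i z) \<le> C * (1 + log_size (s i w)) \<and>
                        log_size (s i w) \<le> C * (1 + log_size (s i z))"
    proof eventually_elim
      case (elim i)
      show ?case
      proof
        fix z assume "z \<in> K"
        then obtain p where p: "p \<in> Q" "z \<in> ball p (\<rho> p)" using Q by blast
        then have pS: "p \<in> S" using Q K by auto
        have pc: "p \<in> ball p (\<rho> p)" using \<rho>(1)[OF pS] by simp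
        have "log_size (s i z) \<le> (C0 * (1 + Cp p)) * (1 + log_size (s i w))"
          by (rule log_size_chain[of _ _ "s i p"]) (use elim p pc C0 Cp pS in auto)
        also have "\<dots> \<le> C * (1 + log_size (s i w))"
          using CQ[OF p(1)] log_size_nonneg[of "s i w"] by (intro mult_right_mono) auto
        finally have 1: "log_size (s i z) \<le> C * (1 + log_size (s i w))" .
        have "log_size (s i w) \<le> (Cp p * (1 + C0)) * (1 + log_size (s i z))"
          by (rule log_size_chain[of _ _ "s i p"]) (use elim p pc C0 Cp pS in auto)
        also have "\<dots> \<le> C * (1 + log_size (s i z))"
          using CQ[OF p(1)] log_size_nonneg[of "s i z"] by (intro mult_right_mono) auto
        finally show "log_size (s i z) \<le> C * (1 + log_size (s i w)) \<and>
                        log_size (s i w) \<le> C * (1 + log_size (s i z))" using 1 by auto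
      qed
    qed
  qed
qed

subsection \<open>Normality and blow-up near the Julia set\<close>

text \<open>Montel's criterion for two omitted values. By the Harnack inequality the behaviour at
  one base point decides: bounded along a subsequence gives local boundedness and a holomorphic
  limit, otherwise the divergence to infinity is locally uniform.\<close>

lemma normal_sequence_if_omits_two:
  fixes s :: "nat \<Rightarrow> complex \<Rightarrow> complex"
  assumes S: "open S" "connected S" "S \<noteq> {}" and pq: "p \<noteq> q"
    and hol: "\<And>n. s n holomorphic_on S"
    and om: "\<forall>\<^sub>F n in sequentially. \<forall>z\<in>S. s n z \<notin> {p,q}"
  shows "\<exists>r :: nat \<Rightarrow> nat. strict_mono r \<and>
           ((\<exists>g. g holomorphic_on S \<and>
                 (\<forall>K. compact K \<and> K \<subseteq> S \<longrightarrow> uniform_limit K (s \<circ> r) g sequentially)) \<or>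
            (\<forall>K. compact K \<and> K \<subseteq> S \<longrightarrow>
                 (\<forall>M::real. \<forall>\<^sub>F n in sequentially. \<forall>z\<in>K. norm (s (r n) z) > M)))"
proof -
  \<comment> \<open>The affine change that moves the omitted values p, q to 0, 1.\<close>
  define u where "u n z = (s n z - p) / (q - p)" for n z
  have su: "s n z = p + (q - p) * u n z" for n z using pq by (simp add: u_def)
  obtain w where w: "w \<in> S" using S(3) by auto
  have loc: "\<exists>r>0. \<forall>\<^sub>F i in sequentially. u i holomorphic_on ball x r \<and> (\<forall>z\<in>ball x r. u i z \<notin> {0,1})"
    if x: "x \<in> S" for x
  proof -
    obtain r where r: "r > 0" "ball x r \<subseteq> S" using S(1) x openE by blast
    have "\<forall>\<^sub>F i in sequentially. u i holomorphic_on ball x r \<and> (\<forall>z\<in>ball x r. u i z \<notin> {0,1})"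
      using om
    proof eventually_elim
      case (elim i)
      have "u i holomorphic_on ball x r" unfolding u_def using pq
        by (intro holomorphic_intros holomorphic_on_subset[OF hol r(2)]) auto
      then show ?case using elim r(2) pq by (auto simp: u_def)
    qed
    then show ?thesis using r(1) by blast
  qed
  show ?thesis
  proof (cases "\<exists>B. \<exists>\<^sub>F n in sequentially. norm (u n w) \<le> B")
    case True
    then obtain B where "\<exists>\<^sub>F n in sequentially. norm (u n w) \<le> B" by blast
    then have inf: "infinite {n. norm (u n w) \<le> B}"
      by (simp add: frequently_cofinite flip: cofinite_eq_sequentially)
    define r0 where "r0 = enumerate {n. norm (u n w) \<le> B}"
    have r0: "strict_mono r0" "\<And>n. norm (u (r0 n) w) \<le> B"
      using strict_mono_enumerate[OF inf] enumerate_in_set[OF inf] by (auto simp: r0_def)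
    have bd: "\<exists>B. \<forall>h \<in> range (s \<circ> r0). \<forall>z\<in>K. norm (h z) \<le> B" if K: "compact K" "K \<subseteq> S" for K
    proof -
      obtain C where C: "C > 0"
        "\<forall>\<^sub>F i in sequentially. \<forall>z\<in>K. log_size (u i z) \<le> C * (1 + log_size (u i w)) \<and>
                        log_size (u i w) \<le> C * (1 + log_size (u i z))"
        using log_size_harnack[OF S(1,2) loc K w] by blast
      define B' where "B' = norm p + norm (q - p) * exp (C * (1 + ln (1 + \<bar>B\<bar>)))"
      have "\<forall>\<^sub>F i in sequentially. \<forall>z\<in>K. norm (s (r0 i) z) \<le> B'"
        using eventually_subseq[OF r0(1) C(2)]
      proof eventually_elim
        case (elim i)
        show ?case
        proof
          fix z assume "z \<in> K"
          then have "log_size (u (r0 i) z) \<le> C * (1 + log_size (u (r0 i) w))" using elim by blast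
          also have "\<dots> \<le> C * (1 + ln (1 + \<bar>B\<bar>))"
            using C(1) r0(2)[of i] log_size_le_iff[of "\<bar>B\<bar>"] by (intro mult_left_mono) auto
          finally have "1 + norm (u (r0 i) z) \<le> exp (C * (1 + ln (1 + \<bar>B\<bar>)))"
            unfolding log_size_def by (subst (asm) exp_le_cancel_iff[symmetric]) (simp add: add_pos_nonneg)
          then have "norm (u (r0 i) z) \<le> exp (C * (1 + ln (1 + \<bar>B\<bar>)))" by simp
          then have "norm ((q - p) * u (r0 i) z) \<le> norm (q - p) * exp (C * (1 + ln (1 + \<bar>B\<bar>)))"
            unfolding norm_mult by (intro mult_left_mono) auto
          then show "norm (s (r0 i) z) \<le> B'" unfolding su B'_def
            using norm_triangle_ineq[of p "(q-p) * u (r0 i) z"] by linarith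
        qed
      qed
      then obtain N where N: "\<And>i z. i \<ge> N \<Longrightarrow> z \<in> K \<Longrightarrow> norm (s (r0 i) z) \<le> B'"
        by (auto simp: eventually_sequentially)
      \<comment> \<open>The Harnack bound holds only from \<open>N\<close> on; the finitely many
        earlier functions are bounded on K by continuity.\<close>
      have "\<forall>i. \<exists>b. \<forall>z\<in>K. norm (s (r0 i) z) \<le> b"
      proof
        fix i
        have "compact (s (r0 i) ` K)"
          using K hol holomorphic_on_imp_continuous_on continuous_on_subset
          by (blast intro: compact_continuous_image)
        then show "\<exists>b. \<forall>z\<in>K. norm (s (r0 i) z) \<le> b"
          using compact_imp_bounded bounded_iff by (metis image_eqI)
      qed
      then obtain b where b: "\<And>i z. z \<in> K \<Longrightarrow> norm (s (r0 i) z) \<le> b i" by metis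
      have "norm (s (r0 i) z) \<le> \<bar>B'\<bar> + (\<Sum>i<N. \<bar>b i\<bar>)" if z: "z \<in> K" for i z
      proof (cases "i \<ge> N")
        case True
        have "0 \<le> (\<Sum>i<N. \<bar>b i\<bar>)" by (intro sum_nonneg) auto
        then show ?thesis using N[OF True z] by linarith
      next
        case False
        have "\<bar>b i\<bar> \<le> (\<Sum>i<N. \<bar>b i\<bar>)" using False by (intro member_le_sum) auto
        then show ?thesis using b[OF z, of i] by linarith
      qed
      then show ?thesis by auto
    qed
    have hol0: "h holomorphic_on S" if "h \<in> range (s \<circ> r0)" for h using that hol by auto
    obtain g r where gr: "g holomorphic_on S" "strict_mono (r :: nat \<Rightarrow> nat)"
      "\<And>K. \<lbrakk>compact K; K \<subseteq> S\<rbrakk> \<Longrightarrow> uniform_limit K ((s \<circ> r0) \<circ> r) g sequentially"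
      by (rule Montel[OF S(1) hol0 bd subset_refl]) (assumption+, rule that)
    show ?thesis
      using gr r0(1) by (intro exI[of _ "r0 \<circ> r"]) (auto simp: strict_mono_o o_assoc)
  next
    case False
    then have inf: "\<forall>\<^sub>F n in sequentially. norm (u n w) > B" for B
      by (auto simp: not_frequently not_le)
    have "\<forall>\<^sub>F n in sequentially. \<forall>z\<in>K. norm (s n z) > M" if K: "compact K" "K \<subseteq> S" for K M
    proof -
      obtain C where C: "C > 0"
        "\<forall>\<^sub>F i in sequentially. \<forall>z\<in>K. log_size (u i z) \<le> C * (1 + log_size (u i w)) \<and>
                        log_size (u i w) \<le> C * (1 + log_size (u i z))"
        using log_size_harnack[OF S(1,2) loc K w] by blast
      \<comment> \<open>Chosen so that \<open>norm u > M'\<close> forces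
        \<open>norm (p + (q - p) * u) > M\<close>.\<close>
      define M' where "M' = (\<bar>M\<bar> + norm p) / norm (q - p)"
      have M': "M' \<ge> 0" by (simp add: M'_def)
      show ?thesis
        using C(2) inf[of "exp (C * (1 + ln (1 + M')))"]
      proof eventually_elim
        case (elim i)
        show ?case
        proof
          fix z assume z: "z \<in> K"
          have "C * (1 + ln (1 + M')) < log_size (u i w)"
          proof -
            have "exp (C * (1 + ln (1 + M'))) < exp (log_size (u i w))"
              using elim(2) by (simp add: log_size_def add_pos_nonneg)
            then show ?thesis by simp
          qed
          also have "\<dots> \<le> C * (1 + log_size (u i z))" using elim z by blast
          finally have "ln (1 + M') < log_size (u i z)" using C(1) by simp
          then have "M' < norm (u i z)" using log_size_le_iff[OF M', of "u i z"] by linarith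
          then have "\<bar>M\<bar> + norm p < norm ((q - p) * u i z)"
            unfolding norm_mult using pq by (simp add: M'_def field_simps)
          then show "M < norm (s i z)" unfolding su
            using norm_diff_ineq[of "(q-p) * u i z" p] by (simp add: add.commute)
        qed
      qed
    qed
    then show ?thesis by (intro exI[of _ id]) (auto simp: strict_mono_id)
  qed
qed

lemma holomorphic_funpow:
  "f holomorphic_on UNIV \<Longrightarrow> (f ^^ n) holomorphic_on UNIV"
proof (induction n)
  case 0
  then show ?case by (simp add: id_def)
next
  case (Suc n)
  then show ?case using holomorphic_on_compose_gen[of "f ^^ n" UNIV f UNIV] by (simp add: o_def)
qed

text \<open>The exponents in a sequence of iterates need not increase. Either one below
  \<open>k\<close> recurs infinitely often, giving a constant subsequence, or they are eventually at
  least \<open>k\<close> and the omitted values apply.\<close>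

lemma normal_family_if_omits_two:
  fixes f :: "complex \<Rightarrow> complex"
  assumes f: "f holomorphic_on UNIV" and S: "plane_domain S" and pq: "p \<noteq> q"
    and om: "\<And>n z. n \<ge> k \<Longrightarrow> z \<in> S \<Longrightarrow> (f ^^ n) z \<notin> {p,q}"
  shows "normal_family_on S {f ^^ n | n. n \<ge> 1}"
  unfolding normal_family_on_def
proof (intro allI impI)
  fix s :: "nat \<Rightarrow> complex \<Rightarrow> complex"
  assume "\<forall>n. s n \<in> {f ^^ n |n. 1 \<le> n}"
  then obtain m where m: "\<And>n. s n = f ^^ m n" by simp metis
  have hol: "s n holomorphic_on S" for n
    using holomorphic_funpow[OF f] m holomorphic_on_subset by (metis subset_UNIV)
  show "\<exists>r :: nat \<Rightarrow> nat. strict_mono r \<and>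
           ((\<exists>g. g holomorphic_on S \<and>
                 (\<forall>K. compact K \<and> K \<subseteq> S \<longrightarrow> uniform_limit K (s \<circ> r) g sequentially)) \<or>
            (\<forall>K. compact K \<and> K \<subseteq> S \<longrightarrow>
                 (\<forall>M::real. \<forall>\<^sub>F n in sequentially. \<forall>z\<in>K. norm (s (r n) z) > M)))"
  proof (cases "\<exists>j<k. infinite {n. m n = j}")
    case True
    then obtain j where j: "infinite {n. m n = j}" by blast
    define r where "r = enumerate {n. m n = j}"
    have r: "strict_mono r" "\<And>n. m (r n) = j"
      using strict_mono_enumerate[OF j] enumerate_in_set[OF j] by (auto simp: r_def)
    have "s \<circ> r = (\<lambda>n. f ^^ j)" using m r by auto
    moreover have "(f ^^ j) holomorphic_on S" using hol[of "r 0"] m r by simp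
    ultimately show ?thesis using r(1)
      by (intro exI[of _ r] conjI disjI1 exI[of _ "f ^^ j"])
         (auto intro!: uniform_limit_const)
  next
    case False
    then have "finite (\<Union>j<k. {n. m n = j})" by simp
    also have "(\<Union>j<k. {n. m n = j}) = {n. \<not> m n \<ge> k}" by auto
    finally have "\<forall>\<^sub>F n in sequentially. m n \<ge> k"
      by (simp add: eventually_cofinite flip: cofinite_eq_sequentially)
    then have "\<forall>\<^sub>F n in sequentially. \<forall>z\<in>S. s n z \<notin> {p,q}"
      by eventually_elim (use om m in auto)
    then show ?thesis
      using normal_sequence_if_omits_two[of S p q s] S pq hol by (auto simp: plane_domain_def)
  qed
qed

text \<open>If all late iterates omitted p and q on N, the family would be normal there and N would
  lie in the Fatou set.\<close>

lemma julia_blow_up: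
  assumes "f holomorphic_on UNIV" "open N" "connected N" "N \<inter> julia_set f \<noteq> {}" "p \<noteq> q"
  obtains n z where "n \<ge> k" "z \<in> N" "(f ^^ n) z \<in> {p,q}"
proof -
  obtain x where x: "x \<in> N" "x \<notin> fatou_set f" using assms(4) by (auto simp: julia_set_def)
  have N: "plane_domain N" using assms x by (auto simp: plane_domain_def)
  then have "\<not> normal_family_on N {f ^^ n | n. n \<ge> 1}" using x unfolding fatou_set_def by blast
  then show ?thesis using normal_family_if_omits_two[OF assms(1) N assms(5), of k] that by blast
qed

section \<open>Value distribution and growth of transcendental entire functions\<close>

text \<open>Great Picard at infinity: a finite limit there would make g constant by Liouville, and a
  limit of 1/g would make g a polynomial.\<close>

lemma transcendental_infinite_values:
  assumes "transcendental_entire g"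
  obtains a where "\<And>w. w \<noteq> a \<Longrightarrow> infinite {z. g z = w}"
proof -
  have hol: "g holomorphic_on UNIV" and np: "\<And>p. \<not> (\<forall>z. g z = poly p z)"
    using assms by (auto simp: transcendental_entire_def)
  have "(g \<circ> inverse) holomorphic_on (UNIV - {0})"
    using hol by (intro holomorphic_on_compose_gen[where t = UNIV] holomorphic_intros) auto
  moreover have "\<not> ((g \<circ> inverse) \<longlongrightarrow> l) (at 0)" for l
  proof
    assume "((g \<circ> inverse) \<longlongrightarrow> l) (at 0)"
    then have "(g \<longlongrightarrow> l) at_infinity" by (simp add: lim_at_infinity_0)
    then have "g z = poly [:l:] z" for z using Liouville_weak[OF hol] by simp
    then show False using np by blast
  qed
  moreover have "\<not> ((inverse \<circ> (g \<circ> inverse)) \<longlongrightarrow> l) (at 0)" for l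
  proof
    assume "((inverse \<circ> (g \<circ> inverse)) \<longlongrightarrow> l) (at 0)"
    then have "((inverse \<circ> g) \<longlongrightarrow> l) at_infinity" by (simp add: lim_at_infinity_0 o_assoc)
    then obtain a n where an: "\<And>z. g z = (\<Sum>i\<le>n. a i * z ^ i)" using pole_at_infinity[OF hol] by blast
    have "g z = poly (\<Sum>i\<le>n. monom (a i) i) z" for z by (simp add: an poly_sum poly_monom)
    then show False using np by blast
  qed
  ultimately obtain a where a: "\<And>w. w \<noteq> a \<Longrightarrow> infinite {x. x \<in> UNIV - {0} \<and> (g \<circ> inverse) x = w}"
    using great_Picard_infinite[of UNIV 0 "g \<circ> inverse"] by (metis UNIV_I open_UNIV)
  show ?thesis
  proof
    fix w assume "w \<noteq> a"
    have "inverse ` {x. x \<in> UNIV - {0} \<and> (g \<circ> inverse) x = w} \<subseteq> {z. g z = w}" by auto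
    moreover have "infinite (inverse ` {x. x \<in> UNIV - {0} \<and> (g \<circ> inverse) x = w})"
      using a[OF \<open>w \<noteq> a\<close>] by (subst finite_image_iff) (auto simp: inj_on_def)
    ultimately show "infinite {z. g z = w}" using finite_subset by blast
  qed
qed

lemma transcendental_not_constant_on:
  assumes "transcendental_entire f"
  shows "\<not> f constant_on UNIV"
proof
  assume "f constant_on UNIV"
  then obtain c where "\<And>z. f z = poly [:c:] z" by (auto simp: constant_on_def)
  then show False using assms unfolding transcendental_entire_def by blast
qed

lemma open_funpow_image:
  assumes "transcendental_entire f" "open S"
  shows "open ((f ^^ n) ` S)"
proof (induction n)
  case (Suc n)
  have "open (f ` (f ^^ n) ` S)"
    using assms Suc transcendental_not_constant_on
    by (intro open_mapping_thm[of f UNIV]) (auto simp: transcendental_entire_def)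
  then show ?case by (simp add: image_comp)
qed (use assms in simp)

text \<open>f takes some value \<open>w\<close> infinitely often. If \<open>f ^^ Suc n\<close> were
  a polynomial, it would take the value \<open>(f ^^ n) w\<close> infinitely often and so be
  constant, against the open mapping theorem.\<close>

lemma transcendental_funpow:
  assumes f: "transcendental_entire f"
  shows "transcendental_entire (f ^^ Suc n)"
proof -
  have "f holomorphic_on UNIV" using f by (simp add: transcendental_entire_def)
  moreover have False if P: "\<And>z. (f ^^ Suc n) z = poly P z" for P
  proof -
    obtain a where a: "\<And>w. w \<noteq> a \<Longrightarrow> infinite {z. f z = w}"
      using transcendental_infinite_values[OF f] by blast
    define w where "w = a + 1"
    have "infinite {z. f z = w}" using a by (simp add: w_def)
    define c where "c = (f ^^ n) w"
    have "{z. f z = w} \<subseteq> {z. poly (P - [:c:]) z = 0}"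
      using P by (auto simp: c_def funpow_swap1 simp flip: P)
    then have "infinite {z. poly (P - [:c:]) z = 0}" using \<open>infinite {z. f z = w}\<close> finite_subset by blast
    then have "P - [:c:] = 0" using poly_roots_finite by blast
    then have "range (f ^^ Suc n) = {c}" using P by auto
    moreover have "open (range (f ^^ Suc n))" using open_funpow_image[OF f open_UNIV] .
    ultimately show False using not_open_singleton[of c] by simp
  qed
  ultimately show ?thesis using holomorphic_funpow[of f "Suc n"] unfolding transcendental_entire_def by blast
qed

text \<open>Some Taylor coefficient of order \<open>n >= N\<close> is nonzero, and Cauchy's
  inequality for it bounds the maximum modulus from below.\<close>

lemma transcendental_growth:
  assumes "transcendental_entire g"
  obtains \<kappa> where "\<kappa> > 0" "\<And>r. r \<ge> 1 \<Longrightarrow> \<exists>z. norm z = r \<and> \<kappa> * r ^ N \<le> norm (g z)"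
proof -
  have hol: "g holomorphic_on UNIV" and np: "\<And>p. \<not> (\<forall>z. g z = poly p z)"
    using assms by (auto simp: transcendental_entire_def)
  have "\<exists>n\<ge>N. (deriv ^^ n) g 0 \<noteq> 0"
  proof (rule ccontr)
    assume "\<not> ?thesis"
    then have d0: "\<And>n. n \<ge> N \<Longrightarrow> (deriv ^^ n) g 0 = 0" by blast
    have "g z = poly (\<Sum>i<N. monom ((deriv ^^ i) g 0 / fact i) i) z" for z
    proof -
      have "(\<lambda>n. (deriv ^^ n) g 0 / fact n * (z - 0) ^ n) sums g z"
        by (rule holomorphic_power_series[of g 0 "norm z + 1"])
           (auto intro: holomorphic_on_subset[OF hol])
      moreover have "(\<lambda>n. (deriv ^^ n) g 0 / fact n * (z - 0) ^ n) sums
          (\<Sum>n<N. (deriv ^^ n) g 0 / fact n * (z - 0) ^ n)"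
        by (rule sums_finite) (use d0 in auto)
      ultimately show ?thesis using sums_unique2 by (fastforce simp: poly_sum poly_monom)
    qed
    then show False using np by blast
  qed
  then obtain n where n: "n \<ge> N" "(deriv ^^ n) g 0 \<noteq> 0" by blast
  \<comment> \<open>Half the modulus of the n-th Taylor coefficient; the factor 2 makes the Cauchy
    estimate contradictory.\<close>
  define \<kappa> where "\<kappa> = norm ((deriv ^^ n) g 0) / (2 * fact n)"
  show ?thesis
  proof
    show "\<kappa> > 0" using n by (simp add: \<kappa>_def)
    fix r :: real assume r: "r \<ge> 1"
    have "\<exists>z. norm z = r \<and> \<kappa> * r ^ n < norm (g z)"
    proof (rule ccontr)
      assume "\<not> ?thesis"
      then have "norm ((deriv ^^ n) g 0) \<le> fact n * (\<kappa> * r ^ n) / r ^ n"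
        using r by (intro Cauchy_inequality holomorphic_on_imp_continuous_on holomorphic_on_subset[OF hol]) force+
      then show False using r n by (simp add: \<kappa>_def)
    qed
    moreover have "\<kappa> * r ^ N \<le> \<kappa> * r ^ n"
      using \<open>\<kappa> > 0\<close> r n by (intro mult_left_mono power_increasing) auto
    ultimately show "\<exists>z. norm z = r \<and> \<kappa> * r ^ N \<le> norm (g z)" by force
  qed
qed

subsection \<open>Bounded orbits, covering and escape\<close>

definition bounded_orbit :: "(complex \<Rightarrow> complex) \<Rightarrow> complex \<Rightarrow> bool" where
  "bounded_orbit f z \<longleftrightarrow> bounded (range (\<lambda>n. (f ^^ n) z))"

lemma funpow_add_apply: "(f ^^ (m + n)) z = (f ^^ m) ((f ^^ n) z)"
  by (simp add: funpow_add)

lemma bounded_orbit_funpow_iff: "bounded_orbit f ((f ^^ k) z) \<longleftrightarrow> bounded_orbit f z"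
proof -
  have "range (\<lambda>n. (f ^^ n) z) = (\<lambda>n. (f ^^ n) z) ` {..<k} \<union> range (\<lambda>n. (f ^^ n) ((f ^^ k) z))"
  proof (intro equalityI subsetI)
    fix x assume "x \<in> range (\<lambda>n. (f ^^ n) z)"
    then obtain n where n: "x = (f ^^ n) z" by blast
    show "x \<in> (\<lambda>n. (f ^^ n) z) ` {..<k} \<union> range (\<lambda>n. (f ^^ n) ((f ^^ k) z))"
    proof (cases "n < k")
      case False
      then have "x = (f ^^ (n - k)) ((f ^^ k) z)" by (simp add: n flip: funpow_add_apply)
      then show ?thesis by blast
    qed (use n in auto)
  qed (auto simp flip: funpow_add_apply)
  then show ?thesis by (simp add: bounded_orbit_def bounded_Un finite_imp_bounded)
qed

text \<open>A point with \<open>f (f p) = p\<close> is the first. Were it the only one, p would be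
  fixed, and Picard for \<open>(f z - p) / (z - p)\<close> would give another point z with
  \<open>f z = p\<close> or \<open>f z = z\<close>, whose orbit is bounded too.\<close>

lemma two_bounded_orbits:
  assumes f: "transcendental_entire f"
  obtains p q where "p \<noteq> q" "bounded_orbit f p" "bounded_orbit f q"
proof -
  have hol: "f holomorphic_on UNIV" and np: "\<And>p. \<not> (\<forall>z. f z = poly p z)"
    using f by (auto simp: transcendental_entire_def)
  have "f \<noteq> (\<lambda>x. a + x)" for a using np[of "[:a, 1:]"] by auto
  then obtain p where p: "f (f p) = p" using holomorphic_involution_point[OF hol] by metis
  have "(f ^^ n) p \<in> {p, f p}" for n by (induction n) (auto simp: p)
  then have "range (\<lambda>n. (f ^^ n) p) \<subseteq> {p, f p}" by blast
  then have bp: "bounded_orbit f p" unfolding bounded_orbit_def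
    using bounded_subset finite_imp_bounded by (meson finite.emptyI finite.insertI)
  note found = that
  show ?thesis
  proof (rule ccontr)
    assume "\<not> thesis"
    then have uniq: "z = p" if "bounded_orbit f z" for z using that bp found by blast
    have step: "bounded_orbit f (f z) \<longleftrightarrow> bounded_orbit f z" for z
      using bounded_orbit_funpow_iff[of f 1 z] by simp
    have fp: "f p = p" using uniq step bp by blast
    define h where "h z = (if z = p then deriv f p else (f z - f p) / (z - p))" for z
    have fh: "f z = p + (z - p) * h z" for z by (simp add: h_def fp)
    have "h holomorphic_on UNIV" unfolding h_def by (rule pole_lemma_open[OF hol open_UNIV])
    moreover have False if "\<And>z. h z = poly P z" for P
      using np[of "[:p:] + [:-p, 1:] * P"] that fh by (simp add: algebra_simps)
    ultimately have "transcendental_entire h" unfolding transcendental_entire_def by blast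
    then obtain a where a: "\<And>w. w \<noteq> a \<Longrightarrow> infinite {z. h z = w}"
      using transcendental_infinite_values by blast
    \<comment> \<open>The Picard exceptional value \<open>a\<close> can coincide with at most one of
      0 and 1.\<close>
    obtain w where w: "w \<noteq> a" "w = 0 \<or> w = 1" by (metis zero_neq_one)
    have "infinite ({z. h z = w} - {p})" using a[OF w(1)] by simp
    then have "{z. h z = w} - {p} \<noteq> {}" by (metis finite.emptyI)
    then obtain z where z: "h z = w" "z \<noteq> p" by blast
    have "f z = p \<or> f z = z" using w(2) z(1) fh[of z] by auto
    then have "bounded_orbit f z"
    proof
      assume "f z = z"
      then have "(f ^^ n) z = z" for n by (induction n) auto
      then show ?thesis by (simp add: bounded_orbit_def)
    qed (use step[of z] bp in auto)
    then show False using uniq z(2) by blast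
  qed
qed

text \<open>Blow-up reaches one of two points of bounded orbit, and boundedness passes back to
  preimages. Such a point supplies the bound at \<zeta>, uniform in the iterate, for the covering
  theorem.\<close>

lemma julia_bounded_orbit:
  assumes f: "transcendental_entire f" and N: "open N" "connected N" "N \<inter> julia_set f \<noteq> {}"
  obtains z where "z \<in> N" "bounded_orbit f z"
proof -
  obtain p q where pq: "p \<noteq> q" "bounded_orbit f p" "bounded_orbit f q" 
    using two_bounded_orbits[OF f] by blast
  have "f holomorphic_on UNIV" using f by (simp add: transcendental_entire_def)
  then obtain n z where "z \<in> N" "(f ^^ n) z \<in> {p,q}" using julia_blow_up[OF _ N pq(1), of 0] by blast
  then show ?thesis using that pq bounded_orbit_funpow_iff[of f n z] by auto
qed

text \<open>A form of Bohr's theorem: if no circle of radius R or 2R lies in the image, then F omits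
  two values whose mutual distance is comparable to R, and Schottky's theorem applies.\<close>
lemma image_contains_circle:
  assumes S: "open S" "connected S" and K: "compact K" "K \<subseteq> S" and \<zeta>: "\<zeta> \<in> S"
  obtains B where "B > 0"
    "\<And>F R z. \<lbrakk>F holomorphic_on S; R > 0; norm (F \<zeta>) \<le> R; z \<in> K; norm (F z) > B * R\<rbrakk>
       \<Longrightarrow> \<exists>R'\<ge>R. sphere 0 R' \<subseteq> F ` S"
proof -
  \<comment> \<open>The principal filter on \<open>X\<close> turns the eventual Harnack estimate
    into one uniform over all functions in \<open>X\<close>.\<close>
  define X where "X = {u. u holomorphic_on S \<and> (\<forall>z\<in>S. u z \<notin> {0,1::complex})}"
  have loc: "\<exists>r>0. \<forall>\<^sub>F u in principal X. u holomorphic_on ball p r \<and> (\<forall>z\<in>ball p r. u z \<notin> {0,1})"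
    if "p \<in> S" for p
  proof -
    obtain r where r: "r > 0" "ball p r \<subseteq> S" using S(1) \<open>p \<in> S\<close> openE by blast
    then show ?thesis
      by (intro exI[of _ r]) (auto simp: eventually_principal X_def intro: holomorphic_on_subset)
  qed
  obtain C where C: "C > 0"
    "\<forall>\<^sub>F u in principal X. \<forall>z\<in>K. log_size (u z) \<le> C * (1 + log_size (u \<zeta>)) \<and>
                        log_size (u \<zeta>) \<le> C * (1 + log_size (u z))"
    using log_size_harnack[OF S loc K \<zeta>] by blast
  define E where "E = exp (C * (1 + ln (1 + 2)))"
  show ?thesis
  proof (rule that[of "1 + 3 * E"])
    show "0 < 1 + 3 * E" by (simp add: E_def add_pos_pos)
    fix F R z
    assume F: "F holomorphic_on S" and R: "R > 0" and F0: "norm (F \<zeta>) \<le> R" and z: "z \<in> K"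
      and big: "norm (F z) > (1 + 3 * E) * R"
    show "\<exists>R'\<ge>R. sphere 0 R' \<subseteq> F ` S"
    proof (rule ccontr)
      assume "\<not> ?thesis"
      then have no: "\<not> sphere 0 R' \<subseteq> F ` S" if "R' \<ge> R" for R' using that by blast
      obtain w1 where "w1 \<in> sphere 0 R" and "w1 \<notin> F ` S" using no[of R] by blast
      then have w1: "norm w1 = R" "w1 \<notin> F ` S" by auto
      have "2 * R \<ge> R" using R by simp
      then obtain w2 where "w2 \<in> sphere 0 (2 * R)" and "w2 \<notin> F ` S" using no[of "2 * R"] by blast
      then have w2: "norm w2 = 2 * R" "w2 \<notin> F ` S" by auto
      \<comment> \<open>Omitted values of moduli R and 2R are at distance between R and 3R, so
        normalising them to 0 and 1 changes sizes by a controlled factor.\<close>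
      have d: "norm (w2 - w1) \<ge> R" "norm (w2 - w1) \<le> 3 * R"
        using norm_triangle_ineq2[of w2 w1] norm_triangle_ineq4[of w2 w1] w1 w2 by auto
      then have ne: "w2 \<noteq> w1" using R by auto
      define u where "u x = (F x - w1) / (w2 - w1)" for x
      have "u \<in> X"
      proof -
        have "u holomorphic_on S" unfolding u_def using ne by (intro holomorphic_intros F) auto
        then show ?thesis using w1(2) w2(2) ne by (auto simp: X_def u_def)
      qed
      then have "log_size (u z) \<le> C * (1 + log_size (u \<zeta>))"
        using C(2) z by (auto simp: eventually_principal)
      also have "\<dots> \<le> C * (1 + ln (1 + 2))"
      proof -
        have "norm (F \<zeta> - w1) \<le> 2 * R" using norm_triangle_ineq4[of "F \<zeta>" w1] F0 w1 by linarith
        also have "\<dots> \<le> 2 * norm (w2 - w1)" using d by simp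
        finally have "norm (u \<zeta>) \<le> 2" using ne by (simp add: u_def norm_divide field_simps)
        then show ?thesis using C(1) log_size_le_iff[of 2 "u \<zeta>"] by (intro mult_left_mono) auto
      qed
      finally have "1 + norm (u z) \<le> E" unfolding log_size_def E_def
        by (subst (asm) exp_le_cancel_iff[symmetric]) (simp add: add_pos_nonneg)
      then have "norm (u z) \<le> E" by simp
      then have "norm (F z - w1) \<le> E * norm (w2 - w1)" using ne by (simp add: u_def norm_divide field_simps)
      also have "\<dots> \<le> E * (3 * R)" using d by (intro mult_left_mono) (auto simp: E_def)
      finally have "norm (F z) \<le> R + E * (3 * R)" using norm_triangle_ineq2[of "F z" w1] w1 by linarith
      then show False using big by (simp add: algebra_simps)
    qed
  qed
qed

section \<open>Planar topology of images\<close>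

text \<open>A complementary component of V that contains a point inside the circle cannot cross the
  circle, hence is bounded and gets filled.\<close>

lemma ball_subset_fill_holes:
  assumes "sphere 0 R \<subseteq> V"
  shows "ball 0 R \<subseteq> fill_holes V"
proof
  fix p :: complex assume p: "p \<in> ball 0 R"
  then have R: "R > 0" by (auto intro: le_less_trans[OF norm_ge_zero])
  show "p \<in> fill_holes V"
  proof (cases "p \<in> V")
    case False
    define C where "C = connected_component_set (UNIV - V) p"
    have C: "C \<in> components (UNIV - V)" "p \<in> C" "C \<subseteq> UNIV - V" "connected C"
      using False connected_component_subset[of "UNIV - V" p]
      by (auto simp: C_def componentsI connected_component_refl)
    have "C \<subseteq> ball 0 R"
    proof (rule ccontr)
      assume "\<not> C \<subseteq> ball 0 R"
      then have "C \<inter> frontier (ball 0 R) \<noteq> {}"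
        using C p by (intro connected_Int_frontier) auto
      moreover have "frontier (ball (0::complex) R) \<subseteq> sphere 0 R"
        by (simp add: frontier_ball[OF R])
      ultimately show False using assms C(3) by blast
    qed
    then have "bounded C" using bounded_subset bounded_ball by blast
    then show ?thesis using C unfolding fill_holes_def by blast
  qed (simp add: fill_holes_def)
qed

lemma frontier_image_meets:
  fixes F :: "complex \<Rightarrow> complex"
  assumes F: "continuous_on UNIV F" "open (F ` U)" and U: "bounded U" "open U"
    and G: "connected G" "\<not> bounded G" and FUG: "F ` U \<inter> G \<noteq> {}"
  obtains \<xi> where "\<xi> \<in> frontier U" "F \<xi> \<in> G"
proof (rule ccontr)
  assume "\<not> thesis"
  then have no: "F ` frontier U \<inter> G = {}" using that by blast
  have cl: "closure U = U \<union> frontier U" by (rule closure_Un_frontier)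
  have cp: "compact (F ` closure U)"
    using F(1) U(1) by (intro compact_continuous_image) (auto intro: continuous_on_subset)
  have eq: "G \<inter> F ` U = G \<inter> F ` closure U" using no unfolding cl by blast
  have "openin (top_of_set G) (G \<inter> F ` U)" using F(2) by (rule openin_open_Int)
  moreover have "closedin (top_of_set G) (G \<inter> F ` U)"
    unfolding eq using cp compact_imp_closed by (intro closedin_closed_Int) auto
  ultimately have "G \<inter> F ` U = G" using G(1) FUG unfolding connected_clopen by blast
  then have "G \<subseteq> F ` closure U" using eq by blast
  then show False using G(2) cp compact_imp_bounded bounded_subset by blast
qed

section \<open>Escape to infinity on the Fatou set\<close>

lemma open_fatou_set: "open (fatou_set f)"
proof -
  have "fatou_set f = \<Union>{S. plane_domain S \<and> normal_family_on S {f ^^ n | n. n \<ge> 1}}"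
    unfolding fatou_set_def by blast
  also have "open \<dots>" by (intro open_Union) (simp add: plane_domain_def)
  finally show ?thesis .
qed

text \<open>Apply normality to the indices where the bound fails: the escaping point excludes a
  finite limit, the failure excludes uniform divergence. The radius is fixed before t, so escape at
  any point of the disc spreads to all of it.\<close>

lemma escape_locally_uniform:
  fixes f :: "complex \<Rightarrow> complex" and m :: "nat \<Rightarrow> nat"
  assumes m: "\<And>i. m i \<ge> 1" and z: "z \<in> fatou_set f"
  obtains r where "r > 0"
    "\<And>t M. \<lbrakk>t \<in> ball z r; filterlim (\<lambda>i. norm ((f ^^ m i) t)) at_top sequentially\<rbrakk>
       \<Longrightarrow> \<forall>\<^sub>F i in sequentially. \<forall>x\<in>ball z r. norm ((f ^^ m i) x) > M"
proof -
  obtain S where S: "open S" "z \<in> S" and nf: "normal_family_on S {f ^^ n | n. n \<ge> 1}"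
    using z unfolding fatou_set_def plane_domain_def by blast
  obtain r where r: "r > 0" "cball z r \<subseteq> S" using S open_contains_cball by blast
  show ?thesis
  proof (rule that[OF r(1)])
    fix t M
    assume t: "t \<in> ball z r" and esc: "filterlim (\<lambda>i. norm ((f ^^ m i) t)) at_top sequentially"
    show "\<forall>\<^sub>F i in sequentially. \<forall>x\<in>ball z r. norm ((f ^^ m i) x) > M"
    proof (rule ccontr)
      define A where "A = {i. \<exists>x\<in>ball z r. norm ((f ^^ m i) x) \<le> M}"
      assume "\<not> ?thesis"
      then have "infinite A"
        by (simp add: A_def not_less eventually_cofinite flip: cofinite_eq_sequentially)
      define e where "e = enumerate A"
      have e: "strict_mono e" "\<And>n. e n \<in> A"
        using strict_mono_enumerate[OF \<open>infinite A\<close>] enumerate_in_set[OF \<open>infinite A\<close>] by (auto simp: e_def)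
      define s where "s n = f ^^ m (e n)" for n
      have "\<forall>n. s n \<in> {f ^^ n | n. n \<ge> 1}" using m by (auto simp: s_def)
      with nf obtain q :: "nat \<Rightarrow> nat" where q: "strict_mono q" and
        alt: "(\<exists>g. g holomorphic_on S \<and>
                 (\<forall>K. compact K \<and> K \<subseteq> S \<longrightarrow> uniform_limit K (s \<circ> q) g sequentially)) \<or>
            (\<forall>K. compact K \<and> K \<subseteq> S \<longrightarrow>
                 (\<forall>M::real. \<forall>\<^sub>F n in sequentially. \<forall>z\<in>K. norm (s (q n) z) > M))"
        unfolding normal_family_on_def by blast
      from alt show False
      proof
        assume "\<exists>g. g holomorphic_on S \<and>
                 (\<forall>K. compact K \<and> K \<subseteq> S \<longrightarrow> uniform_limit K (s \<circ> q) g sequentially)"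
        then obtain g where "\<forall>K. compact K \<and> K \<subseteq> S \<longrightarrow> uniform_limit K (s \<circ> q) g sequentially" by blast
        then have "uniform_limit (cball z r) (s \<circ> q) g sequentially" using r(2) compact_cball by blast
        then have "(\<lambda>n. (s \<circ> q) n t) \<longlonglongrightarrow> g t"
          by (rule tendsto_uniform_limitI) (use t in simp)
        then have lim: "(\<lambda>n. norm (s (q n) t)) \<longlonglongrightarrow> norm (g t)" using tendsto_norm by fastforce
        have "filterlim (\<lambda>n. norm (s (q n) t)) at_top sequentially"
          using filterlim_compose[OF esc filterlim_subseq[OF strict_mono_o[OF e(1) q]]]
          by (simp add: s_def)
        then show False
          using not_tendsto_and_filterlim_at_infinity[OF sequentially_bot lim]
            filterlim_at_top_imp_at_infinity by blast
      next
        assume "\<forall>K. compact K \<and> K \<subseteq> S \<longrightarrow>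
                 (\<forall>M::real. \<forall>\<^sub>F n in sequentially. \<forall>z\<in>K. norm (s (q n) z) > M)"
        then have "\<forall>\<^sub>F n in sequentially. \<forall>z\<in>cball z r. norm (s (q n) z) > M" using r by auto
        then obtain n where n: "\<forall>x\<in>cball z r. norm (s (q n) x) > M"
          using eventually_happens'[OF sequentially_bot] by blast
        have "e (q n) \<in> A" by (rule e)
        then obtain x where x: "x \<in> ball z r" "norm (s (q n) x) \<le> M" unfolding A_def s_def by blast
        then have "M < norm (s (q n) x)" using n ball_subset_cball by blast
        then show False using x(2) by linarith
      qed
    qed
  qed
qed

text \<open>Escape along \<open>m\<close> is locally constant on the Fatou set, so connectedness
  carries it from w to z.\<close>

lemma escape_on_fatou_component:
  fixes f :: "complex \<Rightarrow> complex" and m :: "nat \<Rightarrow> nat"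
  assumes m: "\<And>i. m i \<ge> 1" and G: "connected G" "open G" "G \<subseteq> fatou_set f"
    and w: "w \<in> G" "filterlim (\<lambda>i. norm ((f ^^ m i) w)) at_top sequentially" and z: "z \<in> G"
  obtains r where "r > 0" "\<And>M. \<forall>\<^sub>F i in sequentially. \<forall>x\<in>ball z r. norm ((f ^^ m i) x) > M"
proof -
  define esc where "esc x \<longleftrightarrow> filterlim (\<lambda>i. norm ((f ^^ m i) x)) at_top sequentially" for x
  have unif: "esc x" if "x \<in> B" "\<And>M. \<forall>\<^sub>F i in sequentially. \<forall>x\<in>B. norm ((f ^^ m i) x) > M" for x B
    unfolding esc_def filterlim_at_top_dense
  proof
    fix M show "\<forall>\<^sub>F i in sequentially. M < norm ((f ^^ m i) x)"
      using that(2)[of M] by eventually_elim (use that(1) in auto)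
  qed
  have "esc w \<longleftrightarrow> esc z" using G(1) w(1) z
  proof (rule connected_equivalence_relation)
    fix a assume a: "a \<in> G"
    obtain r where r: "r > 0" "\<And>t M. \<lbrakk>t \<in> ball a r; filterlim (\<lambda>i. norm ((f ^^ m i) t)) at_top sequentially\<rbrakk> \<Longrightarrow>
        \<forall>\<^sub>F i in sequentially. \<forall>x\<in>ball a r. norm ((f ^^ m i) x) > M"
      by (rule escape_locally_uniform[where m = m, OF m subsetD[OF G(3) a]]) (rule that)
    have "esc x \<longleftrightarrow> esc y" if "x \<in> ball a r" "y \<in> ball a r" for x y
      using unif[OF that(2) r(2)[OF that(1)]] unif[OF that(1) r(2)[OF that(2)]] esc_def by blast
    then show "\<exists>T. openin (top_of_set G) T \<and> a \<in> T \<and> (\<forall>x\<in>T. esc a = esc x)"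
      using a r(1) by (intro exI[of _ "G \<inter> ball a r"]) (auto simp: openin_open_Int)
  qed auto
  then have ez: "esc z" using w(2) by (simp add: esc_def)
  obtain r where r: "r > 0" "\<And>t M. \<lbrakk>t \<in> ball z r; filterlim (\<lambda>i. norm ((f ^^ m i) t)) at_top sequentially\<rbrakk> \<Longrightarrow>
      \<forall>\<^sub>F i in sequentially. \<forall>x\<in>ball z r. norm ((f ^^ m i) x) > M"
    by (rule escape_locally_uniform[where m = m, OF m subsetD[OF G(3) z]]) (rule that)
  show ?thesis using that[OF r(1) r(2)[OF _ ez[unfolded esc_def]]] r(1) by simp
qed

subsection \<open>Growth comparison\<close>

text \<open>The covering theorem is used twice. First \<open>f ^^ n\<close> covers a large circle;
  on it \<open>f ^^ j\<close> is as large as a power N of the radius; that value then yields a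
  circle covered by \<open>f ^^ (n + j)\<close>, whose interior is filled.\<close>

lemma image_growth:
  assumes f: "transcendental_entire f" and r: "0 < r2" "r2 < r1" "r1 < r0"
    and \<zeta>: "\<zeta> \<in> ball a r2" "bounded_orbit f \<zeta>" and j: "j \<ge> 1" and N: "N \<ge> 1"
  obtains \<kappa> b0 where "\<kappa> > 0"
    "\<And>n z. \<lbrakk>z \<in> cball a r2; norm ((f ^^ n) z) \<ge> b0\<rbrakk>
       \<Longrightarrow> ball 0 (\<kappa> * norm ((f ^^ n) z) ^ N) \<subseteq> fill_holes ((f ^^ (n + j)) ` ball a r0)"
proof -
  have hol: "(f ^^ n) holomorphic_on X" for n X
    using f holomorphic_funpow holomorphic_on_subset unfolding transcendental_entire_def by blast
  have "transcendental_entire (f ^^ j)" using transcendental_funpow[OF f, of "j - 1"] j by simp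
  then obtain \<kappa>0 where \<kappa>0: "\<kappa>0 > 0" "\<And>r. r \<ge> 1 \<Longrightarrow> \<exists>z. norm z = r \<and> \<kappa>0 * r ^ N \<le> norm ((f ^^ j) z)"
    by (rule transcendental_growth[where N = N]) (rule that)
  obtain R0 where R0: "R0 > 0" "\<And>n. norm ((f ^^ n) \<zeta>) \<le> R0"
    using \<zeta>(2) unfolding bounded_orbit_def bounded_pos by blast
  have sub1: "cball a r2 \<subseteq> ball a r1" "\<zeta> \<in> ball a r1" using r \<zeta> by auto
  obtain B1 where B1: "B1 > 0" "\<And>F R z. \<lbrakk>F holomorphic_on ball a r1; R > 0; norm (F \<zeta>) \<le> R;
      z \<in> cball a r2; norm (F z) > B1 * R\<rbrakk> \<Longrightarrow> \<exists>R'\<ge>R. sphere 0 R' \<subseteq> F ` ball a r1"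
    by (rule image_contains_circle[OF open_ball connected_ball compact_cball sub1]) (rule that)
  have sub2: "cball a r1 \<subseteq> ball a r0" "\<zeta> \<in> ball a r0" using r \<zeta> by auto
  obtain B2 where B2: "B2 > 0" "\<And>F R z. \<lbrakk>F holomorphic_on ball a r0; R > 0; norm (F \<zeta>) \<le> R;
      z \<in> cball a r1; norm (F z) > B2 * R\<rbrakk> \<Longrightarrow> \<exists>R'\<ge>R. sphere 0 R' \<subseteq> F ` ball a r0"
    by (rule image_contains_circle[OF open_ball connected_ball compact_cball sub2]) (rule that)
  define \<kappa> where "\<kappa> = \<kappa>0 / ((2 * B1) ^ N * (2 * B2))"
  \<comment> \<open>Forces R >= 1 for the growth estimate, R >= R0 for the first covering, and,
    since R <= R^N, R2 >= R0 for the second.\<close>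
  define b0 where "b0 = 2 * B1 * Max {1, R0, 2 * B2 * R0 / \<kappa>0}"
  show ?thesis
  proof (rule that)
    show "\<kappa> > 0" using \<kappa>0(1) B1(1) B2(1) by (simp add: \<kappa>_def)
    fix n z assume z: "z \<in> cball a r2" and big: "norm ((f ^^ n) z) \<ge> b0"
    \<comment> \<open>The factor 2 here and in \<open>R2\<close> yields the strict inequality that
      the covering theorem asks for.\<close>
    define R where "R = norm ((f ^^ n) z) / (2 * B1)"
    have "R \<ge> Max {1, R0, 2 * B2 * R0 / \<kappa>0}" using big B1(1)
      unfolding R_def b0_def by (subst pos_le_divide_eq) (simp_all only: mult.commute mult_pos_pos zero_less_numeral)
    then have R: "R \<ge> 1" "R \<ge> R0" "R \<ge> 2 * B2 * R0 / \<kappa>0" by auto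
    have z': "norm ((f ^^ n) z) = 2 * B1 * R" using B1(1) by (simp add: R_def)
    have "\<exists>R'\<ge>R. sphere 0 R' \<subseteq> (f ^^ n) ` ball a r1"
    proof (rule B1(2)[where z = z])
      show "norm ((f ^^ n) \<zeta>) \<le> R" using R0(2)[of n] R by linarith
      have "B1 * R > 0" using B1(1) R(1) by simp
      then show "B1 * R < norm ((f ^^ n) z)" using z' by linarith
    qed (use R(1) z hol in auto)
    then obtain R' where R': "R' \<ge> R" "sphere 0 R' \<subseteq> (f ^^ n) ` ball a r1" by blast
    then obtain v where v: "norm v = R'" "\<kappa>0 * R' ^ N \<le> norm ((f ^^ j) v)" using \<kappa>0(2)[of R'] R by auto
    then have "v \<in> (f ^^ n) ` ball a r1" using R'(2) by auto
    then obtain y where y: "y \<in> ball a r1" "v = (f ^^ n) y" by blast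
    have vy: "(f ^^ j) v = (f ^^ (n + j)) y" by (simp add: y(2) add.commute flip: funpow_add_apply)
    have "\<kappa>0 * R ^ N \<le> \<kappa>0 * R' ^ N" using \<kappa>0(1) R R' by (intro mult_left_mono power_mono) auto
    then have y': "\<kappa>0 * R ^ N \<le> norm ((f ^^ (n + j)) y)" using v(2) unfolding vy by linarith
    define R2 where "R2 = \<kappa>0 * R ^ N / (2 * B2)"
    have "R ^ 1 \<le> R ^ N" using R N by (intro power_increasing)
    then have "2 * B2 * R0 / \<kappa>0 \<le> R ^ N" using R(3) by simp
    then have "R2 \<ge> R0" using \<kappa>0(1) B2(1) by (simp add: R2_def field_simps)
    have "R2 > 0" using \<open>R2 \<ge> R0\<close> R0 by simp
    have "\<exists>R'\<ge>R2. sphere 0 R' \<subseteq> (f ^^ (n + j)) ` ball a r0"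
    proof (rule B2(2)[where z = y])
      show "norm ((f ^^ (n + j)) \<zeta>) \<le> R2" using R0(2)[of "n + j"] \<open>R2 \<ge> R0\<close> by linarith
      have "B2 * R2 = \<kappa>0 * R ^ N / 2" using B2(1) by (simp add: R2_def)
      also have "\<dots> < \<kappa>0 * R ^ N" using \<kappa>0(1) R(1) by simp
      finally show "B2 * R2 < norm ((f ^^ (n + j)) y)" using y' by simp
    qed (use \<open>R2 > 0\<close> y(1) hol in auto)
    then obtain R'' where R'': "R'' \<ge> R2" "sphere 0 R'' \<subseteq> (f ^^ (n + j)) ` ball a r0" by blast
    have "\<kappa> * norm ((f ^^ n) z) ^ N = R2"
      unfolding z' \<kappa>_def R2_def using B1(1) by (simp add: power_mult_distrib)
    then show "ball 0 (\<kappa> * norm ((f ^^ n) z) ^ N) \<subseteq> fill_holes ((f ^^ (n + j)) ` ball a r0)"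
      using ball_subset_fill_holes[OF R''(2)] R''(1) subset_ball[of R2 R'' 0] by (metis subset_trans)
  qed
qed

text \<open>The Harnack bound makes \<open>norm x\<close> at most a constant times b^k, against the
  lower bound of order b^(k+1); hence b stays below a constant independent of x and y.\<close>

lemma log_size_power_bound:
  assumes C: "C > 0" and \<kappa>: "\<kappa> > 0" and b: "b \<ge> 1" and k: "real k \<ge> C"
    and le: "log_size x \<le> C * (1 + log_size y)" "norm y \<le> b" "\<kappa> * b ^ Suc k \<le> norm x"
  shows "b \<le> (2 * exp 1) ^ k / \<kappa>"
proof -
  have "ln (1 + norm x) \<le> C * (1 + log_size y)" using le(1) by (simp add: log_size_def)
  also have "\<dots> \<le> C * (1 + ln (1 + b))"
    using C b log_size_le_iff[of b y] le(2) by (intro mult_left_mono) auto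
  also have "\<dots> \<le> real k * (1 + ln (2 * b))"
    using C b k by (intro mult_mono add_left_mono add_nonneg_nonneg) auto
  also have "\<dots> = real k * ln (exp 1 * (2 * b))" using b by (simp add: ln_mult)
  also have "\<dots> = ln ((exp 1 * (2 * b)) ^ k)" using b by (simp add: ln_realpow)
  finally have "1 + norm x \<le> (exp 1 * (2 * b)) ^ k"
    using b by (subst (asm) ln_le_cancel_iff) (auto intro: add_pos_nonneg)
  then have "\<kappa> * b ^ Suc k \<le> (2 * exp 1) ^ k * b ^ k"
    using le(3) by (simp add: power_mult_distrib mult_ac)
  then have "(\<kappa> * b) * b ^ k \<le> (2 * exp 1) ^ k * b ^ k" by (simp add: mult_ac)
  then have "\<kappa> * b \<le> (2 * exp 1) ^ k" using b by (simp add: mult_le_cancel_right)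
  then show ?thesis using \<kappa> by (simp add: field_simps)
qed

section \<open>Contradiction from an unbounded Fatou component\<close>

theorem theorem6:
  fixes f :: "complex \<Rightarrow> complex" and a :: complex and \<rho> :: real and D :: "complex set"
  assumes "transcendental_entire f"
    and "\<rho> > 0" and "D = ball a \<rho>"
    and "D \<inter> julia_set f \<noteq> {}"
    and "\<exists>U. plane_domain U \<and> bounded U \<and> frontier U \<subseteq> B_set D f \<and> U \<inter> julia_set f \<noteq> {}"
  shows "\<not> (\<exists>C \<in> components (fatou_set f). \<not> bounded C)"
proof
  note f = assms(1)
  have hol: "f holomorphic_on UNIV" using f by (simp add: transcendental_entire_def)
  have cont: "continuous_on X (f ^^ n)" for n X
    using holomorphic_funpow[OF hol] holomorphic_on_imp_continuous_on continuous_on_subset by blast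
  assume "\<exists>G \<in> components (fatou_set f). \<not> bounded G"
  then obtain G where "G \<in> components (fatou_set f)" and unb: "\<not> bounded G" by blast
  then have G: "open G" "connected G" "G \<subseteq> fatou_set f" "G \<noteq> {}"
    using open_components[OF open_fatou_set] in_components_connected in_components_subset
      in_components_nonempty by blast+
  obtain U where U: "open U" "connected U" "bounded U" "frontier U \<subseteq> B_set D f" "U \<inter> julia_set f \<noteq> {}"
    using assms(5) by (auto simp: plane_domain_def)
  \<comment> \<open>Two targets in G: blow-up reaches one of them, so it lands in G either
    way.\<close>
  obtain p q where pq: "p \<in> G" "q \<in> G" "p \<noteq> q"
    using unb by (metis bounded_empty bounded_insert insertI1 is_singletonI' is_singleton_def)
  obtain x where x: "x \<in> ball a \<rho>" "x \<in> julia_set f" using assms(3,4) by blast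
  \<comment> \<open>Three nested discs, the smallest still meeting the Julia set, leave room for the
    two coverings.\<close>
  obtain r2 where r2: "dist a x < r2" "r2 < \<rho>" using x(1) dense by auto
  obtain r1 where r1: "r2 < r1" "r1 < \<rho>" using r2(2) dense by blast
  have r2pos: "r2 > 0" using r2(1) zero_le_dist[of a x] by linarith
  have J2: "ball a r2 \<inter> julia_set f \<noteq> {}" using x r2 by auto
  obtain \<zeta> where \<zeta>: "\<zeta> \<in> ball a r2" "bounded_orbit f \<zeta>"
    using julia_bounded_orbit[OF f _ _ J2] by auto
  obtain l \<zeta>1 where l: "\<zeta>1 \<in> ball a r2" "(f ^^ l) \<zeta>1 \<in> G"
    using julia_blow_up[OF hol _ _ J2 pq(3), of 0] pq by (metis connected_ball empty_iff insertE open_ball)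
  \<comment> \<open>Taking k > l leaves \<open>f ^^ (k - l)\<close> a genuine, hence transcendental,
    iterate.\<close>
  obtain k u where k: "k \<ge> Suc l" "u \<in> U" "(f ^^ k) u \<in> G"
    using julia_blow_up[OF hol U(1,2,5) pq(3), of "Suc l"] pq by (metis empty_iff insertE)
  obtain \<xi> where \<xi>: "\<xi> \<in> frontier U" "(f ^^ k) \<xi> \<in> G"
    using frontier_image_meets[OF cont open_funpow_image[OF f U(1)] U(3,1) G(2) unb, of k] k by blast
  define w0 where "w0 = (f ^^ l) \<zeta>1"
  define w1 where "w1 = (f ^^ k) \<xi>"
  have w: "w0 \<in> G" "w1 \<in> G" using l \<xi> by (simp_all add: w0_def w1_def)
  have "\<exists>n z. n \<ge> Suc l \<and> z \<in> ball a r2 \<and> norm ((f ^^ n) z) > real i" for i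
  proof -
    \<comment> \<open>Both targets have modulus above i, so hitting either shows that late iterates
      are unbounded on the small disc.\<close>
    have "(of_nat (i + 1) :: complex) \<noteq> of_nat (i + 2)" unfolding of_nat_eq_iff by simp
    then obtain n z where nz: "n \<ge> Suc l" "z \<in> ball a r2" "(f ^^ n) z \<in> {of_nat (i + 1), of_nat (i + 2)}"
      by (rule julia_blow_up[OF hol open_ball connected_ball J2])
    have "norm ((f ^^ n) z) \<in> {real (i + 1), real (i + 2)}"
      using nz(3) by (auto simp only: norm_of_nat insert_iff empty_iff)
    then have "norm ((f ^^ n) z) > real i" by auto
    then show ?thesis using nz by blast
  qed
  then obtain n y where ny: "\<And>i. n i \<ge> Suc l" "\<And>i. y i \<in> ball a r2" "\<And>i. norm ((f ^^ n i) (y i)) > real i"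
    by metis
  have "\<exists>z\<in>cball a r2. \<forall>x\<in>cball a r2. norm ((f ^^ n i) x) \<le> norm ((f ^^ n i) z)" for i
    using r2pos by (intro continuous_attains_sup continuous_on_norm cont) auto
  then obtain z where z: "\<And>i. z i \<in> cball a r2"
    "\<And>i x. x \<in> cball a r2 \<Longrightarrow> norm ((f ^^ n i) x) \<le> norm ((f ^^ n i) (z i))" by metis
  define b where "b i = norm ((f ^^ n i) (z i))" for i
  have b: "b i > real i" for i
    using ny(3)[of i] z(2)[of "y i" i] ny(2)[of i] by (simp add: b_def)
  have b_top: "filterlim b at_top sequentially"
    using filterlim_real_sequentially by (rule filterlim_at_top_mono) (simp add: b less_imp_le)
  \<comment> \<open>Splits \<open>f ^^ n i\<close> as \<open>f ^^ m i\<close> after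
    \<open>f ^^ l\<close>; since n i > l, the \<open>m i\<close> are positive, as normality and
    \<open>B_set\<close> require.\<close>
  define m where "m i = n i - l" for i
  have m: "m i \<ge> 1" "n i = m i + l" for i using ny(1)[of i] by (simp_all add: m_def)
  have w0b: "norm ((f ^^ m i) w0) \<le> b i" for i
    using z(2)[of \<zeta>1 i] l(1) by (simp add: w0_def b_def m(2) flip: funpow_add_apply)
  have w1b: "\<exists>\<kappa>>0. \<forall>\<^sub>F i in sequentially. \<kappa> * b i ^ N \<le> norm ((f ^^ m i) w1)" if N: "N \<ge> 1" for N
  proof -
    have "k - l \<ge> 1" using k(1) by simp
    then obtain \<kappa> b0 where \<kappa>: "\<kappa> > 0"
      "\<And>n z. \<lbrakk>z \<in> cball a r2; norm ((f ^^ n) z) \<ge> b0\<rbrakk>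
       \<Longrightarrow> ball 0 (\<kappa> * norm ((f ^^ n) z) ^ N) \<subseteq> fill_holes ((f ^^ (n + (k - l))) ` ball a \<rho>)"
      by (rule image_growth[OF f r2pos r1 \<zeta> _ N]) (rule that)
    have "\<forall>\<^sub>F i in sequentially. b i \<ge> b0" using b_top by (simp add: filterlim_at_top)
    then have "\<forall>\<^sub>F i in sequentially. \<kappa> * b i ^ N \<le> norm ((f ^^ m i) w1)"
    proof eventually_elim
      case (elim i)
      \<comment> \<open>With this exponent the filled image is one that the orbit of \<xi>, a point
        of \<open>B_set D f\<close>, must avoid, so \<open>(f ^^ m i) w1\<close> lies outside the
        disc.\<close>
      have "n i + (k - l) = m i + k" using m(2)[of i] k(1) by simp
      then have "ball 0 (\<kappa> * b i ^ N) \<subseteq> fill_holes ((f ^^ (m i + k)) ` D)"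
        using \<kappa>(2)[OF z(1), of "n i" i] elim by (simp add: b_def assms(3))
      moreover have "(f ^^ (m i + k)) \<xi> \<notin> fill_holes ((f ^^ (m i + k)) ` D)"
        using \<xi>(1) U(4) m(1)[of i] unfolding B_set_def by fastforce
      ultimately have "(f ^^ m i) w1 \<notin> ball 0 (\<kappa> * b i ^ N)"
        unfolding w1_def by (auto simp flip: funpow_add_apply)
      then show ?case by simp
    qed
    then show ?thesis using \<kappa>(1) by blast
  qed
  \<comment> \<open>The power N = 1 already gives escape at \<open>w1\<close>, hence on all of G,
    where eventually 0 and 1 are omitted locally.\<close>
  have w1_top: "filterlim (\<lambda>i. norm ((f ^^ m i) w1)) at_top sequentially"
  proof -
    obtain \<kappa> where \<kappa>: "\<kappa> > 0" "\<forall>\<^sub>F i in sequentially. \<kappa> * b i ^ 1 \<le> norm ((f ^^ m i) w1)"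
      using w1b[of 1] by auto
    have "filterlim (\<lambda>i. \<kappa> * b i) at_top sequentially"
      using b_top \<kappa>(1) by (intro filterlim_tendsto_pos_mult_at_top[OF tendsto_const])
    then show ?thesis by (rule filterlim_at_top_mono) (use \<kappa>(2) in simp)
  qed
  have loc: "\<exists>r>0. \<forall>\<^sub>F i in sequentially. (f ^^ m i) holomorphic_on ball p r \<and>
      (\<forall>z\<in>ball p r. (f ^^ m i) z \<notin> {0,1})" if p: "p \<in> G" for p
  proof -
    obtain r where r: "r > 0" "\<And>M. \<forall>\<^sub>F i in sequentially. \<forall>x\<in>ball p r. norm ((f ^^ m i) x) > M"
      by (rule escape_on_fatou_component[where m = m, OF m(1) G(2,1,3) w(2) w1_top p]) (rule that)
    have "\<forall>\<^sub>F i in sequentially. (f ^^ m i) holomorphic_on ball p r \<and>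
      (\<forall>z\<in>ball p r. (f ^^ m i) z \<notin> {0,1})"
      using r(2)[of 1] by eventually_elim
        (use holomorphic_on_subset[OF holomorphic_funpow[OF hol] subset_UNIV] in force)
    then show ?thesis using r(1) by blast
  qed
  have K: "compact {w1}" "{w1} \<subseteq> G" using w by auto
  obtain C where C: "C > 0" "\<forall>\<^sub>F i in sequentially. \<forall>z\<in>{w1}.
      log_size ((f ^^ m i) z) \<le> C * (1 + log_size ((f ^^ m i) w0)) \<and>
      log_size ((f ^^ m i) w0) \<le> C * (1 + log_size ((f ^^ m i) z))"
    using log_size_harnack[OF G(1,2) loc K w(1)] by blast
  \<comment> \<open>The Harnack constant C is fixed first; only then is the power
    \<open>Suc k'\<close> > C chosen in the lower bound.\<close>
  define k' where "k' = nat \<lceil>C\<rceil>"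
  have k': "real k' \<ge> C" unfolding k'_def by (rule real_nat_ceiling_ge)
  obtain \<kappa> where \<kappa>: "\<kappa> > 0" "\<forall>\<^sub>F i in sequentially. \<kappa> * b i ^ Suc k' \<le> norm ((f ^^ m i) w1)"
    using w1b[of "Suc k'"] by auto
  have "\<forall>\<^sub>F i in sequentially. b i > max 1 ((2 * exp 1) ^ k' / \<kappa>)"
    using b_top by (simp only: filterlim_at_top_dense)
  with C(2) \<kappa>(2) have "\<forall>\<^sub>F i in sequentially. False"
  proof eventually_elim
    case (elim i)
    have "b i \<le> (2 * exp 1) ^ k' / \<kappa>"
      by (rule log_size_power_bound[OF C(1) \<kappa>(1) _ k', of "b i" "(f ^^ m i) w1" "(f ^^ m i) w0"])
        (use elim w0b in auto)
    then show False using elim by simp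
  qed
  then show False by simp
qed

end
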